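(* Let $X$ be a reflexive real or complex Banach space, and let $T$ be a weakly mixing power-bounded operator on $X$. If for some scalar $\alpha$ we have $T=\alpha I+S$, where $S$ is a bounded linear operator on $X$ such that $S^k$ is compact for some integer $k\ge 1$, then $T$ (on $X$) and its adjoint $T^*$ (on $X^*$) are stable.
   Context: Operators are bounded linear operators from a Banach space to itself. An operator $T$ is power-bounded if $\sup_{n\ge 0}\|T^n\|<\infty$. By the mean ergodic theorem, a power-bounded operator $T$ on a reflexive (real or complex) Banach space $X$ is mean ergodic: for every $x\in X$ the limit $Ex:=\lim_{n\to\infty}\frac1n\sum_{k=1}^n T^k x$ exists in norm, and $E=E(T)$ is a bounded projection onto the fixed space $F(T)=\{y: Ty=y\}$ with kernel $\overline{(I-T)X}$. Such a $T$ is called weakly mixing if $\lim_{n\to\infty}\frac1n\sum_{k=1}^n|\langle x^*,T^k(x-Ex)\rangle|=0$ for every $x\in X$ and every $x^*\in X^*$. Such a $T$ is called stable if $\|T^n x-Ex\|\to 0$ as $n\to\infty$ for every $x\in X$. The same definitions are applied to $T^*$ on the reflexive space $X^*$, with $E(T^* )$ in place of $E$. *)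

theory Defs
  imports "HOL-Analysis.Analysis"
begin

(* A Banach space over 'k (instantiated with real or complex) is a type of class banach with a
   scalar multiplication sc over 'k which restricts to scaleR and satisfies |c x| = |c| |x|.
   Over the reals sc is necessarily scaleR, see normed_scaling_real_iff. *)

definition normed_scaling :: "('k::real_normed_field \<Rightarrow> 'a::real_normed_vector \<Rightarrow> 'a) \<Rightarrow> bool" where
  "normed_scaling sc \<longleftrightarrow> vector_space sc \<and>
     (\<forall>r x. sc (of_real r) x = r *\<^sub>R x) \<and> (\<forall>c x. norm (sc c x) = norm c * norm x)"

lemma normed_scaling_real_iff:
  "normed_scaling (sc :: real \<Rightarrow> 'a::real_normed_vector \<Rightarrow> 'a) \<longleftrightarrow> sc = scaleR"
  unfolding normed_scaling_def vector_space_def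
  by (auto simp: fun_eq_iff algebra_simps)

(* Elements of 'a =>_L 'a are real-linear; operators of the space over 'k also commute with sc. *)

definition is_operator :: "('k \<Rightarrow> 'a::real_normed_vector \<Rightarrow> 'a) \<Rightarrow> ('a \<Rightarrow>\<^sub>L 'a) \<Rightarrow> bool" where
  "is_operator sc T \<longleftrightarrow> (\<forall>c x. blinfun_apply T (sc c x) = sc c (blinfun_apply T x))"

(* The dual space over 'k is the closed subspace of 'k-linear functionals in 'a =>_L 'k; the norm
   inherited from 'a =>_L 'k is the dual norm. *)

definition dual :: "('k::real_normed_field \<Rightarrow> 'a::real_normed_vector \<Rightarrow> 'a) \<Rightarrow> ('a \<Rightarrow>\<^sub>L 'k) set" where
  "dual sc = {f. \<forall>c x. blinfun_apply f (sc c x) = c * blinfun_apply f x}"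

lemma dual_scaleR: "dual scaleR = UNIV"
  by (auto simp: dual_def blinfun.scaleR_right)

(* Bounded 'k-linear functionals on dual sc; only their values on dual sc are relevant.
   The functional blinfun_mult_right c o_L f is c f. *)

definition bidual ::
    "('k::real_normed_field \<Rightarrow> 'a::real_normed_vector \<Rightarrow> 'a) \<Rightarrow> (('a \<Rightarrow>\<^sub>L 'k) \<Rightarrow> 'k) set" where
  "bidual sc = {\<phi>. (\<forall>f\<in>dual sc. \<forall>g\<in>dual sc. \<phi> (f + g) = \<phi> f + \<phi> g) \<and>
     (\<forall>c. \<forall>f\<in>dual sc. \<phi> (blinfun_mult_right c o\<^sub>L f) = c * \<phi> f) \<and>
     (\<exists>K. \<forall>f\<in>dual sc. norm (\<phi> f) \<le> K * norm f)}"

definition reflexive_space :: "('k::real_normed_field \<Rightarrow> 'a::real_normed_vector \<Rightarrow> 'a) \<Rightarrow> bool" where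
  "reflexive_space sc \<longleftrightarrow> (\<forall>\<phi>\<in>bidual sc. \<exists>x. \<forall>f\<in>dual sc. \<phi> f = blinfun_apply f x)"

(* The adjoint is used as an operator on dual sc, which it leaves invariant if is_operator sc T. *)

definition adjoint_op :: "('a::real_normed_vector \<Rightarrow>\<^sub>L 'a) \<Rightarrow> ('a \<Rightarrow>\<^sub>L 'k::real_normed_field) \<Rightarrow> ('a \<Rightarrow>\<^sub>L 'k)" where
  "adjoint_op T = (\<lambda>f. f o\<^sub>L T)"

definition power_bounded :: "('a::real_normed_vector \<Rightarrow> 'a) \<Rightarrow> bool" where
  "power_bounded T \<longleftrightarrow> bdd_above (range (\<lambda>n. onorm (T ^^ n)))"

definition mean_ergodic_proj :: "('a::real_normed_vector \<Rightarrow> 'a) \<Rightarrow> 'a \<Rightarrow> 'a" where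
  "mean_ergodic_proj T x = lim (\<lambda>n. (1 / real n) *\<^sub>R (\<Sum>k=1..n. (T ^^ k) x))"

definition weakly_mixing ::
    "('k::real_normed_field \<Rightarrow> 'a::real_normed_vector \<Rightarrow> 'a) \<Rightarrow> ('a \<Rightarrow> 'a) \<Rightarrow> bool" where
  "weakly_mixing sc T \<longleftrightarrow> (\<forall>x. \<forall>f\<in>dual sc.
     (\<lambda>n. (1 / real n) * (\<Sum>k=1..n. norm (blinfun_apply f ((T ^^ k) (x - mean_ergodic_proj T x)))))
       \<longlonglongrightarrow> 0)"

(* The carrier V is UNIV for an operator on the whole type and dual sc for an adjoint. *)

definition stable_on :: "'a::real_normed_vector set \<Rightarrow> ('a \<Rightarrow> 'a) \<Rightarrow> bool" where
  "stable_on V T \<longleftrightarrow> (\<forall>x\<in>V. (\<lambda>n. norm ((T ^^ n) x - mean_ergodic_proj T x)) \<longlonglongrightarrow> 0)"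

definition compact_operator :: "('a::real_normed_vector \<Rightarrow> 'b::real_normed_vector) \<Rightarrow> bool" where
  "compact_operator f \<longleftrightarrow> (\<forall>B. bounded B \<longrightarrow> compact (closure (f ` B)))"

end

theory Submission
  imports Defs
begin

text \<open>
  Let \<open>N\<close> be the closed subspace of vectors whose orbit tends to 0. If \<open>w\<close> is weakly mixing, the orbit
  \<open>S\<^sup>k T\<^sup>n w = T\<^sup>n S\<^sup>k w\<close> lies in a compact set, so weak convergence to 0 in the mean gives norm convergence to 0
  along a subsequence, and power-boundedness gives \<open>S\<^sup>k w \<in> N\<close>. From \<open>S y \<in> N\<close>, that is
  \<open>T y \<equiv> \<alpha> y\<close> modulo \<open>N\<close>, one concludes \<open>y \<in> N\<close>: for \<open>\<bar>\<alpha>\<bar> < 1\<close> by iterating, and otherwise because a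
  functional that vanishes on \<open>N\<close> but not at \<open>y\<close> would contradict weak mixing. Descending from \<open>S\<^sup>k w\<close>
  to \<open>w\<close> yields \<open>w \<in> N\<close>.

  The same descent works for the adjoint: \<open>T\<^sup>n\<close> converges uniformly on the compact closure of the image
  of the unit ball under \<open>S\<^sup>k\<close>, and reflexivity turns the strong convergence of \<open>T\<^sup>n\<close> into weak convergence
  of the powers of the adjoint.
\<close>

section \<open>Separation of points from closed subspaces\<close>

definition sublinear :: "('v::real_vector \<Rightarrow> real) \<Rightarrow> bool" where
  "sublinear p \<longleftrightarrow> (\<forall>x y. p (x + y) \<le> p x + p y) \<and> (\<forall>t x. 0 \<le> t \<longrightarrow> p (t *\<^sub>R x) \<le> t * p x)"

lemma sublinearI:
  assumes "\<And>x y. p (x + y) \<le> p x + p y" "\<And>t x. 0 \<le> t \<Longrightarrow> p (t *\<^sub>R x) \<le> t * p x"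
  shows "sublinear p"
  using assms by (simp add: sublinear_def)

lemma sublinear_add: "sublinear p \<Longrightarrow> p (x + y) \<le> p x + p y"
  and sublinear_scaleR_le: "sublinear p \<Longrightarrow> 0 \<le> t \<Longrightarrow> p (t *\<^sub>R x) \<le> t * p x"
  by (auto simp: sublinear_def)

lemma sublinear_0: "sublinear p \<Longrightarrow> p 0 = 0"
  using sublinear_add[of p 0 0] sublinear_scaleR_le[of p 0 0] by simp

lemma sublinear_scaleR:
  assumes p: "sublinear p" and t: "0 \<le> t"
  shows "p (t *\<^sub>R x) = t * p x"
proof (cases "t = 0")
  case True
  then show ?thesis using sublinear_0[OF p] by simp
next
  case False
  then have "p x \<le> inverse t * p (t *\<^sub>R x)"
    using sublinear_scaleR_le[OF p, of "inverse t" "t *\<^sub>R x"] t by simp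
  then have "t * p x \<le> p (t *\<^sub>R x)"
    using False t by (simp add: field_simps)
  then show ?thesis using sublinear_scaleR_le[OF p t, of x] by simp
qed

lemma sublinear_minus_ge: "sublinear p \<Longrightarrow> - p (- x) \<le> p x"
  using sublinear_add[of p x "- x"] sublinear_0[of p] by simp

text \<open>The largest sublinear functional below \<open>p\<close> whose value at \<open>- z\<close> is at most \<open>- p z\<close>.\<close>

definition lower_at :: "('v::real_vector \<Rightarrow> real) \<Rightarrow> 'v \<Rightarrow> 'v \<Rightarrow> real" where
  "lower_at p z x = (INF t\<in>{0..}. p (x + t *\<^sub>R z) - t * p z)"

text \<open>Subadditivity of \<open>p\<close> gives the lower bound \<open>- p (- x)\<close>, so the
  infimum is finite. Parameters \<open>t\<close> and \<open>s\<close> for two summands add up to a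
  parameter for the sum, and scaling by \<open>r > 0\<close> rescales the parameter.\<close>

lemma
  assumes p: "sublinear p"
  shows lower_at_le: "0 \<le> t \<Longrightarrow> lower_at p z x \<le> p (x + t *\<^sub>R z) - t * p z"
    and sublinear_lower_at: "sublinear (lower_at p z)"
proof -
  have "- p (- x) \<le> p (x + t *\<^sub>R z) - t * p z" if "0 \<le> t" for t x
    using sublinear_add[OF p, of "x + t *\<^sub>R z" "- x"] sublinear_scaleR[OF p that, of z] by simp
  then have bdd: "bdd_below ((\<lambda>t. p (x + t *\<^sub>R z) - t * p z) ` {0..})" for x
    by (intro bdd_belowI2[where m = "- p (- x)"]) auto
  show le: "lower_at p z x \<le> p (x + t *\<^sub>R z) - t * p z" if "0 \<le> t" for t x
    unfolding lower_at_def using that by (intro cINF_lower[OF bdd]) auto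
  show "sublinear (lower_at p z)"
  proof (rule sublinearI)
    fix x y
    have *: "lower_at p z (x + y) \<le> (p (x + t *\<^sub>R z) - t * p z) + (p (y + s *\<^sub>R z) - s * p z)"
      if "0 \<le> t" "0 \<le> s" for t s
    proof -
      have "lower_at p z (x + y) \<le> p ((x + y) + (t + s) *\<^sub>R z) - (t + s) * p z"
        using that by (intro le) auto
      also have "(x + y) + (t + s) *\<^sub>R z = (x + t *\<^sub>R z) + (y + s *\<^sub>R z)"
        by (simp add: algebra_simps)
      finally show ?thesis
        using sublinear_add[OF p, of "x + t *\<^sub>R z" "y + s *\<^sub>R z"] by (simp add: algebra_simps)
    qed
    have "lower_at p z (x + y) - (p (y + s *\<^sub>R z) - s * p z) \<le> lower_at p z x" if "0 \<le> s" for s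
      unfolding lower_at_def[of p z x] using *[OF _ that] by (intro cINF_greatest) (auto simp: algebra_simps)
    then have "lower_at p z (x + y) - lower_at p z x \<le> lower_at p z y"
      unfolding lower_at_def[of p z y] by (intro cINF_greatest) (auto simp: algebra_simps)
    then show "lower_at p z (x + y) \<le> lower_at p z x + lower_at p z y"
      by simp
  next
    fix r :: real and x
    assume r: "0 \<le> r"
    show "lower_at p z (r *\<^sub>R x) \<le> r * lower_at p z x"
    proof (cases "r = 0")
      case True
      then show ?thesis using le[of 0 0] sublinear_0[OF p] by simp
    next
      case False
      have "lower_at p z (r *\<^sub>R x) / r \<le> p (x + t *\<^sub>R z) - t * p z" if "0 \<le> t" for t
      proof -
        have "lower_at p z (r *\<^sub>R x) \<le> p (r *\<^sub>R x + (r * t) *\<^sub>R z) - (r * t) * p z"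
          using that r by (intro le) auto
        also have "r *\<^sub>R x + (r * t) *\<^sub>R z = r *\<^sub>R (x + t *\<^sub>R z)"
          by (simp add: algebra_simps)
        also have "p \<dots> = r * p (x + t *\<^sub>R z)"
          by (rule sublinear_scaleR[OF p r])
        finally show ?thesis using r False by (simp add: field_simps)
      qed
      then have "lower_at p z (r *\<^sub>R x) / r \<le> lower_at p z x"
        unfolding lower_at_def[of p z x] by (intro cINF_greatest) auto
      then show ?thesis using r False by (simp add: field_simps)
    qed
  qed
qed

text \<open>By Zorn's lemma there is a minimal sublinear functional below \<open>p\<close>; it is linear because it
  coincides with its own \<^const>\<open>lower_at\<close>, for every \<open>z\<close>.\<close>

lemma sublinear_dominates_linear:
  fixes p :: "'v::real_vector \<Rightarrow> real"
  assumes p: "sublinear p"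
  obtains u where "linear u" "\<And>x. u x \<le> p x"
proof -
  define A where "A = {q. sublinear q \<and> (\<forall>x. q x \<le> p x)}"
  \<comment> \<open>Zorn's lemma yields a maximal element, so the order is reversed: larger means
    pointwise smaller.\<close>
  let ?P = "\<lambda>f g :: 'v \<Rightarrow> real. g \<le> f"
  have "\<exists>m\<in>A. \<forall>a\<in>A. ?P m a \<longrightarrow> a = m"
  proof (rule predicate_Zorn)
    show "partial_order_on A (relation_of ?P A)"
      by (auto simp: partial_order_on_def preorder_on_def refl_on_def relation_of_def
          intro!: transI antisymI)
    fix C assume C: "C \<in> Chains (relation_of ?P A)"
    then have sub: "C \<subseteq> A" and chain: "\<And>f g. f \<in> C \<Longrightarrow> g \<in> C \<Longrightarrow> f \<le> g \<or> g \<le> f"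
      by (auto simp: Chains_def relation_of_def)
    show "\<exists>u\<in>A. \<forall>a\<in>C. ?P a u"
    proof (cases "C = {}")
      case True
      then show ?thesis using p by (auto simp: A_def)
    next
      case False
      \<comment> \<open>The bound for the chain. It is finite because every member is at least
        \<open>- p (- x)\<close> at \<open>x\<close>, and subadditive because the smaller of two
        members can be used for both arguments.\<close>
      define u where "u x = (INF f\<in>C. f x)" for x
      have bdd: "bdd_below ((\<lambda>f. f x) ` C)" for x
      proof (rule bdd_belowI2)
        fix f assume "f \<in> C"
        then have f: "sublinear f" "f (- x) \<le> p (- x)"
          using sub by (auto simp: A_def)
        show "- p (- x) \<le> f x" using sublinear_minus_ge[OF f(1), of x] f(2) by linarith
      qed
      have le: "u x \<le> f x" if "f \<in> C" for f x
        unfolding u_def by (rule cINF_lower[OF bdd that])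
      have "sublinear u"
      proof (rule sublinearI)
        fix x y
        have *: "u (x + y) \<le> f x + g y" if fg: "f \<in> C" "g \<in> C" for f g
        proof -
          obtain h where h: "h \<in> C" "h \<le> f" "h \<le> g"
            using chain[OF fg] fg by blast
          have "u (x + y) \<le> h x + h y"
            using le[OF h(1), of "x + y"] sublinear_add[of h x y] subsetD[OF sub h(1)]
            by (simp add: A_def)
          then show ?thesis
            using le_funD[OF h(2), of x] le_funD[OF h(3), of y] by linarith
        qed
        have "u (x + y) - g y \<le> u x" if "g \<in> C" for g
          unfolding u_def[of x] using *[OF _ that] False
          by (intro cINF_greatest) (auto simp: algebra_simps)
        then have "u (x + y) - u x \<le> u y"
          unfolding u_def[of y] using False by (intro cINF_greatest) (auto simp: algebra_simps)
        then show "u (x + y) \<le> u x + u y" by simp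
      next
        fix r :: real and x
        assume r: "0 \<le> r"
        have hom: "u (r *\<^sub>R x) \<le> r * f x" if "f \<in> C" for f
          using le[OF that, of "r *\<^sub>R x"] sublinear_scaleR_le[OF _ r, of f x] subsetD[OF sub that]
          by (simp add: A_def)
        show "u (r *\<^sub>R x) \<le> r * u x"
        proof (cases "r = 0")
          case True
          then show ?thesis using hom False by auto
        next
          case rn: False
          have "u (r *\<^sub>R x) / r \<le> u x"
            unfolding u_def[of x] using hom r rn False
            by (intro cINF_greatest) (auto simp: field_simps)
          then show ?thesis using r rn by (simp add: field_simps)
        qed
      qed
      moreover have "u x \<le> p x" for x
      proof -
        obtain f where f: "f \<in> C" using False by blast
        then show ?thesis using le[OF f, of x] subsetD[OF sub f] by (auto simp: A_def intro: order_trans)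
      qed
      ultimately have "u \<in> A" by (simp add: A_def)
      then show ?thesis using le by (auto simp: le_fun_def)
    qed
  qed
  then obtain u where uA: "u \<in> A" and minA: "\<And>q. q \<in> A \<Longrightarrow> q \<le> u \<Longrightarrow> q = u"
    by blast
  then have u: "sublinear u" "\<And>x. u x \<le> p x"
    by (auto simp: A_def)
  have min: "q = u" if "sublinear q" "\<And>x. q x \<le> u x" for q
    using that order_trans[OF that(2) u(2)] by (intro minA) (auto simp: A_def le_fun_def)
  have minus: "u (- z) = - u z" for z
  proof -
    \<comment> \<open>The parameter \<open>t = 0\<close> shows \<open>lower_at u z \<le> u\<close>,
      so minimality applies; \<open>t = 1\<close> at \<open>- z\<close> then yields
      \<open>u (- z) \<le> - u z\<close>.\<close>
    have "lower_at u z = u"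
      using lower_at_le[OF u(1), of 0 z] by (intro min sublinear_lower_at u(1)) auto
    then have "u (- z) \<le> - u z"
      using lower_at_le[OF u(1), of 1 z "- z"] sublinear_0[OF u(1)] by simp
    then show ?thesis using sublinear_minus_ge[OF u(1), of z] by simp
  qed
  have "linear u"
  proof (rule linearI)
    show "u (x + y) = u x + u y" for x y
      using sublinear_add[OF u(1), of x y] sublinear_add[OF u(1), of "- x" "- y"] minus[of x]
        minus[of y] minus[of "x + y"] by simp
    show "u (r *\<^sub>R x) = r *\<^sub>R u x" for r x
      using sublinear_scaleR[OF u(1), of r x] sublinear_scaleR[OF u(1), of "- r" x]
        minus[of "r *\<^sub>R x"] by (cases "0 \<le> r") auto
  qed
  then show ?thesis using u(2) by (rule that)
qed

section \<open>Distance to a subspace and separation over the reals\<close>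

lemma infdist_approx:
  fixes V :: "'v::real_normed_vector set"
  assumes "V \<noteq> {}" "0 < e"
  obtains v where "v \<in> V" "norm (x - v) < infdist x V + e"
proof -
  have "\<exists>v\<in>V. dist x v < infdist x V + e"
    using assms cINF_less_iff[of V "dist x" "infdist x V + e"]
    by (auto simp: infdist_notempty)
  with that show ?thesis by (auto simp: dist_norm)
qed

lemma sublinear_infdist:
  fixes V :: "'v::real_normed_vector set"
  assumes V: "subspace V"
  shows "sublinear (\<lambda>x. infdist x V)"
proof (rule sublinearI)
  have ne: "V \<noteq> {}" using subspace_0[OF V] by auto
  show "infdist (x + y) V \<le> infdist x V + infdist y V" for x y
  proof (rule field_le_epsilon)
    fix e :: real assume "0 < e"
    then obtain v w where vw: "v \<in> V" "norm (x - v) < infdist x V + e / 2"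
        "w \<in> V" "norm (y - w) < infdist y V + e / 2"
      using infdist_approx[OF ne, of "e / 2"] by (metis half_gt_zero)
    have "infdist (x + y) V \<le> norm ((x - v) + (y - w))"
      using infdist_le[of "v + w" V "x + y"] subspace_add[OF V] vw
      by (simp add: dist_norm algebra_simps)
    then show "infdist (x + y) V \<le> infdist x V + infdist y V + e"
      using norm_triangle_ineq[of "x - v" "y - w"] vw by linarith
  qed
  fix r :: real and x assume r: "0 \<le> r"
  show "infdist (r *\<^sub>R x) V \<le> r * infdist x V"
  proof (cases "r = 0")
    case True
    then show ?thesis using subspace_0[OF V] by simp
  next
    case False
    have "infdist (r *\<^sub>R x) V / r \<le> dist x v" if "v \<in> V" for v
    proof -
      have "infdist (r *\<^sub>R x) V \<le> dist (r *\<^sub>R x) (r *\<^sub>R v)"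
        by (rule infdist_le[OF subspace_scale[OF V that]])
      also have "\<dots> = r * dist x v"
        using r norm_scaleR[of r "x - v"] by (simp add: dist_norm scaleR_diff_right)
      finally show ?thesis using r False by (simp add: divide_le_eq mult.commute)
    qed
    then have "infdist (r *\<^sub>R x) V / r \<le> infdist x V"
      unfolding infdist_notempty[OF ne, of x] using ne by (intro cINF_greatest)
    then show ?thesis using r False by (simp add: field_simps)
  qed
qed

text \<open>Take a linear minorant of \<open>lower_at p y\<close>, where \<open>p\<close> is the
  distance to \<open>V\<close>. Being below \<open>p\<close>, it vanishes on \<open>V\<close> and
  has norm at most 1; being below \<open>lower_at p y\<close>, it satisfies
  \<open>u y \<ge> p y > 0\<close>.\<close>

lemma separation_real:
  fixes V :: "'v::real_normed_vector set"
  assumes V: "subspace V" and y: "y \<notin> closure V"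
  obtains u :: "'v \<Rightarrow>\<^sub>L real" where "\<And>v. v \<in> V \<Longrightarrow> blinfun_apply u v = 0" "blinfun_apply u y \<noteq> 0"
proof -
  define p where "p x = infdist x V" for x
  have p: "sublinear p"
    unfolding p_def by (rule sublinear_infdist[OF V])
  obtain u where u: "linear u" and le: "\<And>x. u x \<le> lower_at p y x"
    using sublinear_dominates_linear[OF sublinear_lower_at[OF p]] by blast
  have up: "u x \<le> p x" for x
    using le[of x] lower_at_le[OF p, of 0 y x] by simp
  have "norm (u x) \<le> 1 * norm x" for x
    using up[of x] up[of "- x"] linear_neg[OF u, of x] infdist_le[OF subspace_0[OF V], of x]
      infdist_le[OF subspace_0[OF V], of "- x"] by (simp add: p_def)
  then have bl: "bounded_linear u"
    using u by (intro bounded_linear_intro[where K = 1]) (auto simp: linear_add linear_scale mult.commute)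
  show ?thesis
  proof (rule that[of "Blinfun u"])
    show "blinfun_apply (Blinfun u) v = 0" if "v \<in> V" for v
      using up[of v] up[of "- v"] linear_neg[OF u, of v] subspace_neg[OF V that] that
      by (simp add: bounded_linear_Blinfun_apply[OF bl] p_def)
    have "0 < p y"
      using y subspace_0[OF V] in_closure_iff_infdist_zero[of V y] infdist_nonneg[of y V]
      by (auto simp: p_def less_le)
    moreover have "u (- y) \<le> - p y"
      using le[of "- y"] lower_at_le[OF p, of 1 y "- y"] sublinear_0[OF p] by simp
    ultimately show "blinfun_apply (Blinfun u) y \<noteq> 0"
      using linear_neg[OF u, of y] by (simp add: bounded_linear_Blinfun_apply[OF bl])
  qed
qed

section \<open>General scalars and separation over the complex numbers\<close>

locale scaled_space =
  fixes sc :: "'k::real_normed_field \<Rightarrow> 'v::real_normed_vector \<Rightarrow> 'v"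
  assumes normed_scaling: "normed_scaling sc"
begin

sublocale vector_space sc
  using normed_scaling by (simp add: normed_scaling_def)

lemma scale_of_real [simp]: "sc (of_real r) x = r *\<^sub>R x"
  and norm_scale [simp]: "norm (sc c x) = norm c * norm x"
  using normed_scaling by (auto simp: normed_scaling_def)

lemma scale_scaleR: "sc c (r *\<^sub>R x) = r *\<^sub>R sc c x"
  by (metis scale_left_commute scale_of_real)

lemma bounded_linear_scale: "bounded_linear (sc c)"
  by (rule bounded_linear_intro[where K = "norm c"])
    (auto simp: scale_right_distrib scale_scaleR mult.commute)

end

text \<open>The conclusion of the Hahn-Banach theorem as a property of the scalar multiplication. It
  lets real and complex scalars, and a space and its dual, be treated by the same argument.\<close>

definition separating :: "('k::real_normed_field \<Rightarrow> 'v::real_normed_vector \<Rightarrow> 'v) \<Rightarrow> bool" where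
  "separating sc \<longleftrightarrow> (\<forall>V y. module.subspace sc V \<longrightarrow> y \<notin> closure V \<longrightarrow>
     (\<exists>f\<in>dual sc. (\<forall>v\<in>V. blinfun_apply f v = 0) \<and> blinfun_apply f y \<noteq> 0))"

lemma separatingE:
  assumes "separating sc" "module.subspace sc V" "y \<notin> closure V"
  obtains f where "f \<in> dual sc" "\<And>v. v \<in> V \<Longrightarrow> blinfun_apply f v = 0" "blinfun_apply f y \<noteq> 0"
  using assms unfolding separating_def by blast

lemma separating_real: "separating (scaleR :: real \<Rightarrow> 'v::real_normed_vector \<Rightarrow> 'v)"
  unfolding separating_def subspace_raw_def[symmetric] dual_scaleR
  by (metis UNIV_I separation_real)

text \<open>A complex functional is recovered from its real part \<open>u\<close> as \<open>u x - \<i> u (\<i> x)\<close>.\<close>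

lemma separating_complex:
  assumes "normed_scaling (sc :: complex \<Rightarrow> 'v::real_normed_vector \<Rightarrow> 'v)"
  shows "separating sc"
  unfolding separating_def
proof (intro allI impI)
  interpret scaled_space sc by unfold_locales fact
  fix V y assume V: "module.subspace sc V" and y: "y \<notin> closure V"
  have "real_vector.subspace V"
    using subspace_0[OF V] subspace_add[OF V] subspace_scale[OF V, of _ "of_real _"]
    by (auto intro!: real_vector.subspaceI)
  then obtain u :: "'v \<Rightarrow>\<^sub>L real" where u: "\<And>v. v \<in> V \<Longrightarrow> blinfun_apply u v = 0" "blinfun_apply u y \<noteq> 0"
    using separation_real[OF _ y] by blast
  define f where "f x = complex_of_real (blinfun_apply u x) - \<i> * complex_of_real (blinfun_apply u (sc \<i> x))" for x
  have bl: "bounded_linear f"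
    unfolding f_def
    by (intro bounded_linear_sub bounded_linear_compose[OF bounded_linear_mult_right]
        bounded_linear_compose[OF bounded_linear_of_real] blinfun.bounded_linear_right
        bounded_linear_compose[OF blinfun.bounded_linear_right bounded_linear_scale])
  have fsc: "f (sc c x) = c * f x" for c x
  proof -
    have c: "sc c z = Re c *\<^sub>R z + Im c *\<^sub>R sc \<i> z" for z
    proof -
      have "sc c z = sc (of_real (Re c) + of_real (Im c) * \<i>) z"
        by (simp add: complex_eq mult.commute)
      also have "\<dots> = Re c *\<^sub>R z + Im c *\<^sub>R sc \<i> z"
        unfolding scale_left_distrib scale_scale[symmetric] scale_of_real ..
      finally show ?thesis .
    qed
    have "sc \<i> (sc c x) = Re c *\<^sub>R sc \<i> x - Im c *\<^sub>R x"
      using c[of "sc \<i> x"] scale_left_commute[of \<i> c x] scale_of_real[of "-1" x] by simp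
    then have i: "sc \<i> (Re c *\<^sub>R x + Im c *\<^sub>R sc \<i> x) = Re c *\<^sub>R sc \<i> x - Im c *\<^sub>R x"
      unfolding c[of x] .
    show ?thesis
      unfolding f_def c[of x] i
      by (simp only: blinfun.bilinear_simps) (simp add: complex_eq_iff algebra_simps)
  qed
  show "\<exists>f\<in>dual sc. (\<forall>v\<in>V. blinfun_apply f v = 0) \<and> blinfun_apply f y \<noteq> 0"
  proof (intro bexI[of _ "Blinfun f"] conjI ballI)
    show "blinfun_apply (Blinfun f) v = 0" if "v \<in> V" for v
      using that u(1) subspace_scale[OF V] by (simp add: bounded_linear_Blinfun_apply[OF bl] f_def)
    show "blinfun_apply (Blinfun f) y \<noteq> 0"
      using u(2) by (simp add: bounded_linear_Blinfun_apply[OF bl] f_def complex_eq_iff)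
    show "Blinfun f \<in> dual sc"
      using fsc by (simp add: dual_def bounded_linear_Blinfun_apply[OF bl])
  qed
qed

section \<open>The dual space with its scalar multiplication\<close>

abbreviation dual_scale :: "'k::real_normed_field \<Rightarrow> ('v::real_normed_vector \<Rightarrow>\<^sub>L 'k) \<Rightarrow> ('v \<Rightarrow>\<^sub>L 'k)" where
  "dual_scale c f \<equiv> blinfun_mult_right c o\<^sub>L f"

text \<open>The upper bound for the norm, applied to \<open>inverse c\<close>, gives the lower
  bound.\<close>

lemma normed_scaling_dual_scale:
  "normed_scaling (dual_scale :: 'k::real_normed_field \<Rightarrow> ('v::real_normed_vector \<Rightarrow>\<^sub>L 'k) \<Rightarrow> _)"
proof -
  have le: "norm (dual_scale c f) \<le> norm c * norm f" for c and f :: "'v \<Rightarrow>\<^sub>L 'k"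
    by (rule norm_blinfun_bound)
      (auto simp: norm_mult mult.assoc intro: mult_left_mono norm_blinfun)
  have "norm (dual_scale c f) = norm c * norm f" for c and f :: "'v \<Rightarrow>\<^sub>L 'k"
  proof (cases "c = 0")
    case True
    then show ?thesis using le[of c f] by simp
  next
    case False
    have "dual_scale (inverse c) (dual_scale c f) = f"
      using False by (intro blinfun_eqI) simp
    then have "norm f \<le> inverse (norm c) * norm (dual_scale c f)"
      using le[of "inverse c" "dual_scale c f"] by (simp add: norm_inverse)
    then show ?thesis
      using le[of c f] False by (simp add: field_simps)
  qed
  moreover have "vector_space (dual_scale :: 'k \<Rightarrow> ('v \<Rightarrow>\<^sub>L 'k) \<Rightarrow> _)"
    by unfold_locales (auto intro!: blinfun_eqI simp: blinfun.bilinear_simps algebra_simps)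
  ultimately show ?thesis
    unfolding normed_scaling_def
    by (auto intro!: blinfun_eqI simp: blinfun.bilinear_simps scaleR_conv_of_real)
qed

text \<open>The restriction of \<open>F\<close> to \<open>dual sc\<close> belongs to the bidual,
  hence is evaluation at a point; nothing is claimed for real-linear maps outside
  \<open>dual sc\<close>.\<close>

lemma reflexive_dual_scaleE:
  assumes "reflexive_space sc" "F \<in> dual (dual_scale :: 'k::real_normed_field \<Rightarrow> ('v::real_normed_vector \<Rightarrow>\<^sub>L 'k) \<Rightarrow> _)"
  obtains x where "\<And>f. f \<in> dual sc \<Longrightarrow> blinfun_apply F f = blinfun_apply f x"
proof -
  have "blinfun_apply F \<in> bidual sc"
    using assms(2) unfolding bidual_def dual_def
    by (auto simp: blinfun.bilinear_simps intro!: exI[of _ "norm F"] norm_blinfun)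
  then show ?thesis
    using assms(1) that unfolding reflexive_space_def by blast
qed

lemma dual_compose:
  assumes "f \<in> dual sc" "is_operator sc K"
  shows "f o\<^sub>L K \<in> dual sc"
  using assms by (simp add: dual_def is_operator_def)

section \<open>Powers, Cesaro means and stability\<close>

lemma bounded_linear_funpow:
  fixes f :: "'v::real_normed_vector \<Rightarrow> 'v"
  assumes "bounded_linear f"
  shows "bounded_linear (f ^^ n)"
proof (induction n)
  case 0
  then show ?case using bounded_linear_ident by (simp add: id_def)
next
  case (Suc n)
  then show ?case using bounded_linear_compose[OF assms Suc] by (simp add: o_def)
qed

text \<open>Past some \<open>N\<close> the terms are within \<open>e / 2\<close> of the limit; the
  first \<open>N\<close> terms contribute at most the constant \<open>C\<close>, and
  \<open>C / n\<close> is eventually below \<open>e / 2\<close>.\<close>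

lemma tendsto_average:
  fixes X :: "nat \<Rightarrow> 'v::real_normed_vector"
  assumes "X \<longlonglongrightarrow> l"
  shows "(\<lambda>n. (1 / real n) *\<^sub>R (\<Sum>k=1..n. X k)) \<longlonglongrightarrow> l"
proof (rule LIMSEQ_I)
  fix e :: real assume e: "0 < e"
  then obtain N where N: "\<And>n. n \<ge> N \<Longrightarrow> norm (X n - l) < e / 2"
    using LIMSEQ_D[OF assms, of "e / 2"] by auto
  define C where "C = (\<Sum>k=1..N. norm (X k - l))"
  obtain n0 :: nat where n0: "2 * C / e < real n0"
    using reals_Archimedean2 by blast
  show "\<exists>no. \<forall>n\<ge>no. norm ((1 / real n) *\<^sub>R (\<Sum>k=1..n. X k) - l) < e"
  proof (intro exI allI impI)
    \<comment> \<open>\<open>Suc n0\<close> rather than \<open>n0\<close> keeps \<open>n\<close>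
      positive and avoids the default \<open>1 / 0 = 0\<close>.\<close>
    fix n assume n: "n \<ge> Suc n0"
    have "(1 / real n) *\<^sub>R (\<Sum>k=1..n. X k) - l = (1 / real n) *\<^sub>R (\<Sum>k=1..n. X k - l)"
      using n by (simp add: sum_subtractf scaleR_diff_right scaleR_conv_of_real[symmetric] sum_constant_scaleR)
    also have "norm \<dots> \<le> (1 / real n) * (\<Sum>k=1..n. norm (X k - l))"
      by (simp add: divide_right_mono norm_sum)
    also have "(\<Sum>k=1..n. norm (X k - l)) \<le> (\<Sum>k=1..n. (if k \<le> N then norm (X k - l) else 0) + e / 2)"
      using N e by (intro sum_mono) (auto simp: less_imp_le)
    also have "\<dots> = (\<Sum>k\<in>{1..n} \<inter> {..N}. norm (X k - l)) + real n * (e / 2)"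
      using sum.inter_restrict[of "{1..n}" "\<lambda>k. norm (X k - l)" "{..N}"] by (simp add: sum.distrib)
    also have "(\<Sum>k\<in>{1..n} \<inter> {..N}. norm (X k - l)) \<le> C"
      unfolding C_def by (intro sum_mono2) auto
    finally have "norm ((1 / real n) *\<^sub>R (\<Sum>k=1..n. X k) - l) \<le> (1 / real n) * (C + real n * (e / 2))"
      by (simp add: mult_left_mono divide_right_mono)
    also have "\<dots> < e"
    proof -
      have "2 * C < e * real n"
        using n0 n e by (simp add: field_simps) (smt (verit) mult_left_mono of_nat_mono of_nat_Suc)
      then show ?thesis using n by (simp add: field_simps)
    qed
    finally show "norm ((1 / real n) *\<^sub>R (\<Sum>k=1..n. X k) - l) < e" .
  qed
qed

text \<open>The Cesaro means of a convergent orbit have the same limit, so this limit is the mean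
  ergodic projection.\<close>

lemma stable_onI:
  assumes "\<And>x. x \<in> V \<Longrightarrow> convergent (\<lambda>n. (T ^^ n) x)"
  shows "stable_on V T"
  unfolding stable_on_def mean_ergodic_proj_def
proof
  fix x assume "x \<in> V"
  then obtain l where l: "(\<lambda>n. (T ^^ n) x) \<longlonglongrightarrow> l"
    using assms by (auto simp: convergent_def)
  then show "(\<lambda>n. norm ((T ^^ n) x - lim (\<lambda>n. (1 / real n) *\<^sub>R (\<Sum>k=1..n. (T ^^ k) x)))) \<longlonglongrightarrow> 0"
    using limI[OF tendsto_average[OF l]] by (simp add: LIM_zero tendsto_norm_zero)
qed

section \<open>Power-bounded operators\<close>

text \<open>A plain function with an explicit bound \<open>M\<close>, so that the adjoint can be an
  instance with the same \<open>M\<close>.\<close>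

locale power_bounded_op = scaled_space sc
  for sc :: "'k::real_normed_field \<Rightarrow> 'v::banach \<Rightarrow> 'v" +
  fixes L :: "'v \<Rightarrow> 'v" and M :: real
  assumes bounded_linear: "bounded_linear L"
    and scale: "L (sc c x) = sc c (L x)"
    and M_ge_1: "1 \<le> M"
    and norm_pow_le: "norm ((L ^^ n) x) \<le> M * norm x"
begin

lemmas bounded_linear_pow = bounded_linear_funpow[OF bounded_linear]

lemma pow_scale: "(L ^^ n) (sc c x) = sc c ((L ^^ n) x)"
  by (induction n) (simp_all add: scale)

lemmas pow_add = linear_add[OF bounded_linear.linear[OF bounded_linear_pow]]
  and pow_diff = linear_diff[OF bounded_linear.linear[OF bounded_linear_pow]]
  and pow_0 = linear_0[OF bounded_linear.linear[OF bounded_linear_pow]]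
  and op_diff = linear_diff[OF bounded_linear.linear[OF bounded_linear]]

section \<open>Vectors with orbit tending to 0\<close>

definition null :: "'v set" where
  "null = {z. (\<lambda>n. (L ^^ n) z) \<longlonglongrightarrow> 0}"

text \<open>Once an orbit element has norm below \<open>e / M\<close>, power-boundedness keeps all
  later ones below \<open>e\<close>.\<close>

lemma null_if_small:
  assumes "\<And>e. 0 < e \<Longrightarrow> \<exists>n. norm ((L ^^ n) z) < e"
  shows "z \<in> null"
proof -
  have "(\<lambda>n. (L ^^ n) z) \<longlonglongrightarrow> 0"
  proof (rule LIMSEQ_I)
    fix e :: real assume "0 < e"
    then obtain n where n: "norm ((L ^^ n) z) < e / M"
      using assms[of "e / M"] M_ge_1 by auto
    have "norm ((L ^^ m) z - 0) < e" if "m \<ge> n" for m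
    proof -
      have "(L ^^ m) z = (L ^^ (m - n)) ((L ^^ n) z)"
        using that by (simp add: funpow_add[symmetric, THEN fun_cong, unfolded o_def])
      then have "norm ((L ^^ m) z) \<le> M * norm ((L ^^ n) z)"
        using norm_pow_le by simp
      also have "\<dots> < e" using n M_ge_1 by (simp add: field_simps)
      finally show ?thesis by simp
    qed
    then show "\<exists>n. \<forall>m\<ge>n. norm ((L ^^ m) z - 0) < e" by blast
  qed
  then show ?thesis by (simp add: null_def)
qed

lemma nullD: "z \<in> null \<Longrightarrow> 0 < e \<Longrightarrow> \<exists>n. norm ((L ^^ n) z) < e"
  using LIMSEQ_D[of "\<lambda>n. (L ^^ n) z" 0 e] by (auto simp: null_def)

lemma subspace_null: "subspace null"
proof (rule subspaceI)
  show "0 \<in> null" by (simp add: null_def pow_0)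
  show "x + y \<in> null" if "x \<in> null" "y \<in> null" for x y
    using that tendsto_add[of "\<lambda>n. (L ^^ n) x" 0 _ "\<lambda>n. (L ^^ n) y" 0] by (simp add: null_def pow_add)
  show "sc c x \<in> null" if "x \<in> null" for c x
    using that bounded_linear.tendsto[OF bounded_linear_scale[of c], of "\<lambda>n. (L ^^ n) x" 0]
    by (simp add: null_def pow_scale)
qed

text \<open>Replacing \<open>x\<close> by a point of \<open>null\<close> within
  \<open>e / (2 * M)\<close> changes every orbit element by less than \<open>e / 2\<close>.
  Closedness allows functionals to separate any vector outside \<open>null\<close> from it.\<close>

lemma closure_null: "closure null = null"
proof (intro equalityI closure_subset subsetI)
  fix x assume x: "x \<in> closure null"
  show "x \<in> null"
  proof (rule null_if_small)
    fix e :: real assume e: "0 < e"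
    then obtain z where z: "z \<in> null" "dist z x < e / (2 * M)"
      using x M_ge_1 unfolding closure_approachable by (metis divide_pos_pos less_le_trans mult_pos_pos zero_less_numeral zero_less_one)
    then obtain n where n: "norm ((L ^^ n) z) < e / 2"
      using nullD[OF z(1), of "e / 2"] e by auto
    have "norm ((L ^^ n) x) \<le> norm ((L ^^ n) z) + norm ((L ^^ n) (x - z))"
      using norm_triangle_ineq[of "(L ^^ n) z" "(L ^^ n) (x - z)"] by (simp add: pow_diff)
    also have "norm ((L ^^ n) (x - z)) \<le> M * dist z x"
      using norm_pow_le[of n "x - z"] by (simp add: dist_norm norm_minus_commute)
    also have "\<dots> < e / 2"
      using z(2) M_ge_1 by (simp add: field_simps)
    finally show "\<exists>n. norm ((L ^^ n) x) < e" using n by (intro exI[of _ n]) simp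
  qed
qed

lemma op_null: "z \<in> null \<Longrightarrow> L z \<in> null"
  unfolding null_def using LIMSEQ_Suc[of "\<lambda>n. (L ^^ n) z"] by (simp add: funpow_swap1)

text \<open>Modulo \<open>null\<close>, the vector \<open>y\<close> is an eigenvector for \<open>\<alpha>\<close>. If \<open>\<bar>\<alpha>\<bar> < 1\<close> its orbit tends to 0;
  otherwise a functional separating \<open>y\<close> from \<open>null\<close> does not decrease along the orbit.\<close>

lemma eigenvector_mod_null:
  assumes sep: "separating sc" and y: "L y - sc \<alpha> y \<in> null"
    and weak: "\<And>F. F \<in> dual sc \<Longrightarrow> (\<And>n. norm (blinfun_apply F y) \<le> norm (blinfun_apply F ((L ^^ n) y)))
                 \<Longrightarrow> blinfun_apply F y = 0"
  shows "y \<in> null"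
proof -
  have pow: "(L ^^ n) y - sc (\<alpha> ^ n) y \<in> null" for n
  proof (induction n)
    case 0
    then show ?case using subspace_0[OF subspace_null] by simp
  next
    case (Suc n)
    have "(L ^^ Suc n) y - sc (\<alpha> ^ Suc n) y
        = L ((L ^^ n) y - sc (\<alpha> ^ n) y) + sc (\<alpha> ^ n) (L y - sc \<alpha> y)"
      by (simp add: op_diff scale scale_right_diff_distrib mult.commute)
    also have "\<dots> \<in> null"
      by (intro subspace_add subspace_scale subspace_null op_null Suc y)
    finally show ?case .
  qed
  show ?thesis
  proof (cases "norm \<alpha> < 1")
    case True
    show ?thesis
    proof (rule null_if_small)
      fix e :: real assume e: "0 < e"
      \<comment> \<open>First \<open>n\<close> makes the whole orbit of
        \<open>sc (\<alpha> ^ n) y\<close> small; then \<open>m\<close> handles the remainder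
        \<open>z\<close>, which lies in \<open>null\<close>.\<close>
      have "(\<lambda>n. M * (norm \<alpha> ^ n * norm y)) \<longlonglongrightarrow> M * (0 * norm y)"
        using True by (intro tendsto_intros LIMSEQ_realpow_zero) auto
      then obtain n where n: "norm (M * (norm \<alpha> ^ n * norm y)) < e / 2"
        using LIMSEQ_D[of _ 0 "e / 2"] e by fastforce
      define z where "z = (L ^^ n) y - sc (\<alpha> ^ n) y"
      obtain m where m: "norm ((L ^^ m) z) < e / 2"
        using nullD[OF pow[of n], of "e / 2"] e by (auto simp: z_def)
      have "(L ^^ (m + n)) y = (L ^^ m) z + (L ^^ m) (sc (\<alpha> ^ n) y)"
        by (simp add: z_def funpow_add pow_diff)
      then have "norm ((L ^^ (m + n)) y) \<le> norm ((L ^^ m) z) + norm ((L ^^ m) (sc (\<alpha> ^ n) y))"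
        by (simp only: norm_triangle_ineq)
      also have "\<dots> < e"
        using norm_pow_le[of m "sc (\<alpha> ^ n) y"] n m by (simp add: norm_power)
      finally show "\<exists>n. norm ((L ^^ n) y) < e" by blast
    qed
  next
    case False
    show ?thesis
    proof (rule ccontr)
      assume "y \<notin> null"
      then obtain F where F: "F \<in> dual sc" "\<And>z. z \<in> null \<Longrightarrow> blinfun_apply F z = 0"
          "blinfun_apply F y \<noteq> 0"
        using separatingE[OF sep subspace_null] by (metis closure_null)
      have "norm (blinfun_apply F y) \<le> norm (blinfun_apply F ((L ^^ n) y))" for n
      proof -
        have "blinfun_apply F ((L ^^ n) y) = \<alpha> ^ n * blinfun_apply F y"
          using F(2)[OF pow[of n]] F(1) by (simp add: blinfun.diff_right dual_def)
        then show ?thesis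
          using False one_le_power[of "norm \<alpha>" n] mult_right_mono[of 1 "norm \<alpha> ^ n" "norm (blinfun_apply F y)"]
          by (simp add: norm_mult norm_power)
      qed
      then show False using weak[OF F(1)] F(3) by blast
    qed
  qed
qed

text \<open>Factors of the power are removed one at a time: if \<open>L y - sc \<alpha> y\<close> is
  null, then \<open>y\<close> is an eigenvector modulo \<open>null\<close>. The invariant set
  \<open>W\<close> carries the weak decay hypothesis through all stages; it is chosen differently
  for the operator and for its adjoint.\<close>

lemma null_if_iterate_null:
  assumes sep: "separating sc"
    and inv: "\<And>y. y \<in> W \<Longrightarrow> L y - sc \<alpha> y \<in> W"
    and weak: "\<And>y F. y \<in> W \<Longrightarrow> F \<in> dual sc \<Longrightarrow>
      (\<And>n. norm (blinfun_apply F y) \<le> norm (blinfun_apply F ((L ^^ n) y))) \<Longrightarrow> blinfun_apply F y = 0"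
    and y: "y \<in> W" "((\<lambda>y. L y - sc \<alpha> y) ^^ k) y \<in> null"
  shows "y \<in> null"
  using y
proof (induction k arbitrary: y)
  case (Suc k)
  have "L y - sc \<alpha> y \<in> null"
    using Suc.prems(2) by (intro Suc.IH[OF inv[OF Suc.prems(1)]]) (simp only: funpow_Suc_right o_apply)
  then show ?case
    by (rule eigenvector_mod_null[OF sep _ weak[OF Suc.prems(1)]])
qed simp

text \<open>If the conclusion fails, the orbit of \<open>K w\<close> stays away from 0, and finitely many functionals detect this on the
  compact closure of the orbit, so that one of them cannot tend to 0 in the mean.\<close>

lemma compact_image_null:
  fixes K :: "'v \<Rightarrow>\<^sub>L 'v"
  assumes sep: "separating sc"
    and mix: "\<And>f. f \<in> dual sc \<Longrightarrow>
      (\<lambda>n. (1 / real n) * (\<Sum>k=1..n. norm (blinfun_apply f ((L ^^ k) w)))) \<longlonglongrightarrow> 0"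
    and K: "is_operator sc K" "\<And>x. L (blinfun_apply K x) = blinfun_apply K (L x)"
      "compact_operator (blinfun_apply K)"
  shows "blinfun_apply K w \<in> null"
proof (rule ccontr)
  assume "blinfun_apply K w \<notin> null"
  then obtain d where d: "0 < d" "\<And>n. d \<le> norm ((L ^^ n) (blinfun_apply K w))"
    using null_if_small[of "blinfun_apply K w"] by (metis not_le)
  have LK: "(L ^^ n) (blinfun_apply K x) = blinfun_apply K ((L ^^ n) x)" for n x
    by (induction n) (simp_all add: K(2))
  define C where "C = closure (blinfun_apply K ` range (\<lambda>n. (L ^^ n) w))"
  have "bounded (range (\<lambda>n. (L ^^ n) w))"
    using norm_pow_le by (auto intro!: boundedI)
  then have C: "compact C"
    using K(3) by (simp add: compact_operator_def C_def)
  \<comment> \<open>The bound \<open>d \<le> norm c\<close> is a closed condition, so it passes from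
    the orbit to its closure and keeps 0 out of \<open>C\<close>.\<close>
  have "C \<subseteq> {c. d \<le> norm c}"
    unfolding C_def using d(2)
    by (intro closure_minimal closed_Collect_le continuous_intros) (auto simp: LK)
  then have "\<exists>f\<in>dual sc. blinfun_apply f c \<noteq> 0" if "c \<in> C" for c
    using that d(1) separatingE[OF sep subspace_single_0, of c] by force
  then obtain f where f: "\<And>c. c \<in> C \<Longrightarrow> f c \<in> dual sc" "\<And>c. c \<in> C \<Longrightarrow> blinfun_apply (f c) c \<noteq> 0"
    by metis
  \<comment> \<open>Normalized so that \<open>g c c = 1\<close> for \<open>c\<close> in
    \<open>C\<close>; the set where \<open>g c\<close> exceeds 1/2 is then an open neighbourhood of
    \<open>c\<close>.\<close>
  define g where "g c y = norm (blinfun_apply (f c) y) / norm (blinfun_apply (f c) c)" for c y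
  have "open {y. 1 / 2 < g c y}" if "c \<in> C" for c
    unfolding g_def using f(2)[OF that] by (intro open_Collect_less continuous_intros) auto
  moreover have "C \<subseteq> (\<Union>c\<in>C. {y. 1 / 2 < g c y})"
    using f(2) by (auto simp: g_def)
  ultimately obtain C' where C': "C' \<subseteq> C" "finite C'" "C \<subseteq> (\<Union>c\<in>C'. {y. 1 / 2 < g c y})"
    using compactE_image[OF C, of C "\<lambda>c. {y. 1 / 2 < g c y}"] by metis
  have g_nonneg: "0 \<le> g c y" for c y by (simp add: g_def)
  have ge: "1 / 2 \<le> (\<Sum>c\<in>C'. g c (blinfun_apply K ((L ^^ n) w)))" for n
  proof -
    have "blinfun_apply K ((L ^^ n) w) \<in> C"
      unfolding C_def by (intro subsetD[OF closure_subset] imageI rangeI)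
    then obtain c where c: "c \<in> C'" "1 / 2 < g c (blinfun_apply K ((L ^^ n) w))"
      using C'(3) by auto
    then show ?thesis
      using member_le_sum[OF c(1), of "\<lambda>c. g c (blinfun_apply K ((L ^^ n) w))"] C'(2) g_nonneg
      by simp
  qed
  \<comment> \<open>Weak mixing of \<open>w\<close> is used with the functionals
    \<open>f c o\<^sub>L K\<close>, so the means of the finite sums tend to 0 although each sum is
    at least 1/2.\<close>
  have "(\<lambda>n. \<Sum>c\<in>C'. (1 / real n) * (\<Sum>k=1..n. norm (blinfun_apply (f c o\<^sub>L K) ((L ^^ k) w)))
        / norm (blinfun_apply (f c) c)) \<longlonglongrightarrow> (\<Sum>c\<in>C'. 0 / norm (blinfun_apply (f c) c))"
    using f C'(1) by (intro tendsto_sum tendsto_divide tendsto_const mix dual_compose K(1)) auto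
  moreover have "(\<Sum>c\<in>C'. (1 / real n) * (\<Sum>k=1..n. norm (blinfun_apply (f c o\<^sub>L K) ((L ^^ k) w)))
        / norm (blinfun_apply (f c) c)) = (1 / real n) * (\<Sum>k=1..n. \<Sum>c\<in>C'. g c (blinfun_apply K ((L ^^ k) w)))" for n
    unfolding g_def
    by (subst sum.swap) (simp add: sum_distrib_left sum_divide_distrib)
  ultimately have "(\<lambda>n. (1 / real n) * (\<Sum>k=1..n. \<Sum>c\<in>C'. g c (blinfun_apply K ((L ^^ k) w)))) \<longlonglongrightarrow> 0"
    by simp
  moreover have "1 / 2 \<le> (1 / real n) * (\<Sum>k=1..n. \<Sum>c\<in>C'. g c (blinfun_apply K ((L ^^ k) w)))"
    if "n \<ge> 1" for n
    using sum_mono[of "{1..n}" "\<lambda>_. 1 / 2", OF ge] that by (simp add: field_simps)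
  ultimately have "(1 / 2 :: real) \<le> 0"
    by (meson LIMSEQ_le_const)
  then show False by simp
qed

section \<open>Cesaro averages and the mean ergodic theorem\<close>

definition average :: "nat \<Rightarrow> 'v \<Rightarrow> 'v" where
  "average n x = (1 / real n) *\<^sub>R (\<Sum>k=1..n. (L ^^ k) x)"

lemma average_add: "average n (x + y) = average n x + average n y"
  by (simp add: average_def pow_add sum.distrib scaleR_add_right)

lemma average_diff: "average n (x - y) = average n x - average n y"
  by (simp add: average_def pow_diff sum_subtractf scaleR_diff_right)

lemma average_scale: "average n (sc c x) = sc c (average n x)"
  by (simp add: average_def pow_scale scale_scaleR scale_sum_right)

lemma average_op: "average n (L x) = L (average n x)"
  unfolding average_def
  by (simp add: linear_scale[OF bounded_linear.linear[OF bounded_linear]]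
      linear_sum[OF bounded_linear.linear[OF bounded_linear]] funpow_swap1)

lemma norm_average_le: "norm (average n x) \<le> M * norm x"
proof (cases "n = 0")
  case True
  then show ?thesis using M_ge_1 by (simp add: average_def)
next
  case False
  have "norm (\<Sum>k=1..n. (L ^^ k) x) \<le> real n * (M * norm x)"
    using sum_norm_le[of "{1..n}" "\<lambda>k. (L ^^ k) x" "\<lambda>_. M * norm x"] norm_pow_le by simp
  then show ?thesis using False by (simp add: average_def field_simps)
qed

text \<open>The sum telescopes to two terms whose norms are bounded independently of
  \<open>n\<close>, and it is divided by \<open>n\<close>.\<close>

lemma average_coboundary: "(\<lambda>n. average n (L x - x)) \<longlonglongrightarrow> 0"
proof (rule Lim_null_comparison[OF always_eventually, OF allI])
  have "(\<Sum>k=1..n. (L ^^ k) (L x - x)) = (L ^^ Suc n) x - L x" for n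
    by (induction n) (simp_all add: pow_diff funpow_swap1 op_diff)
  then have "norm (average n (L x - x)) = (1 / real n) * norm ((L ^^ n) (L x) - L x)" for n
    by (simp add: average_def funpow_swap1)
  moreover have "norm ((L ^^ n) (L x) - L x) \<le> 2 * M * norm (L x)" for n
    using norm_triangle_ineq4[of "(L ^^ n) (L x)" "L x"] norm_pow_le[of n "L x"]
      mult_right_mono[OF M_ge_1, of "norm (L x)"] by simp
  ultimately show "norm (average n (L x - x)) \<le> (1 / real n) * (2 * M * norm (L x))" for n
    by (simp add: divide_right_mono)
  show "(\<lambda>n. (1 / real n) * (2 * M * norm (L x))) \<longlonglongrightarrow> 0"
    using tendsto_mult_left_zero[OF lim_1_over_n[where 'a = real]] by simp
qed

lemma subspace_average_convergent: "subspace {x. convergent (\<lambda>n. average n x)}"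
proof (rule subspaceI)
  show "0 \<in> {x. convergent (\<lambda>n. average n x)}"
    by (simp add: average_def pow_0 convergent_const)
qed (simp_all add: average_add average_scale convergent_add
      bounded_linear.convergent[OF bounded_linear_scale])

text \<open>Averaging is bounded by \<open>M\<close> uniformly in \<open>n\<close>, so the averages
  of \<open>x\<close> stay within \<open>e / 3\<close> of those of a nearby point of convergence and
  are Cauchy.\<close>

lemma closed_average_convergent:
  assumes x: "x \<in> closure {x. convergent (\<lambda>n. average n x)}"
  shows "convergent (\<lambda>n. average n x)"
proof (rule Cauchy_convergent, rule metric_CauchyI)
  fix e :: real assume e: "0 < e"
  then have "0 < e / (3 * M)" using M_ge_1 by simp
  then obtain z where z: "convergent (\<lambda>n. average n z)" "dist z x < e / (3 * M)"
    using x unfolding closure_approachable by blast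
  then obtain N where N: "\<And>m n. m \<ge> N \<Longrightarrow> n \<ge> N \<Longrightarrow> dist (average m z) (average n z) < e / 3"
    using metric_CauchyD[OF convergent_Cauchy[OF z(1)], of "e / 3"] e by auto
  have near: "dist (average n x) (average n z) < e / 3" for n
  proof -
    have "dist (average n x) (average n z) \<le> M * dist z x"
      using norm_average_le[of n "x - z"] by (simp add: dist_norm average_diff norm_minus_commute)
    also have "\<dots> < e / 3" using z(2) M_ge_1 by (simp add: field_simps)
    finally show ?thesis .
  qed
  have "dist (average m x) (average n x) < e" if "m \<ge> N" "n \<ge> N" for m n
    using N[OF that] near[of m] near[of n] dist_triangle[of "average m x" "average n x" "average m z"]
      dist_triangle[of "average m z" "average n x" "average n z"]
    by (simp add: dist_commute)
  then show "\<exists>N. \<forall>m\<ge>N. \<forall>n\<ge>N. dist (average m x) (average n x) < e" by blast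
qed

text \<open>The averages of \<open>L x - x\<close> tend to 0, and \<open>L\<close> commutes with
  averaging.\<close>

lemma fixed_if_average_tendsto:
  assumes "(\<lambda>n. average n x) \<longlonglongrightarrow> p"
  shows "L p = p"
proof -
  have "(\<lambda>n. L (average n x) - average n x) \<longlonglongrightarrow> L p - p"
    by (intro tendsto_diff bounded_linear.tendsto[OF bounded_linear] assms)
  moreover have "(\<lambda>n. L (average n x) - average n x) \<longlonglongrightarrow> 0"
    using average_coboundary[of x] by (simp add: average_diff average_op)
  ultimately have "L p - p = 0"
    by (rule LIMSEQ_unique)
  then show ?thesis by simp
qed

text \<open>Mean ergodic theorem. A functional \<open>f\<close> vanishing on the subspace of convergence is a fixed point of the
  adjoint outside the closed range of the adjoint minus the identity; by reflexivity, a fixed vector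
  \<open>y\<close> with \<open>f y \<noteq> 0\<close> separates \<open>f\<close> from this range, although \<open>y\<close> has convergent averages.\<close>

lemma average_convergent:
  assumes sep: "separating sc" and sep': "separating (dual_scale :: 'k \<Rightarrow> ('v \<Rightarrow>\<^sub>L 'k) \<Rightarrow> _)"
    and refl: "reflexive_space sc"
  shows "convergent (\<lambda>n. average n x)"
proof (rule ccontr)
  let ?D = "{x. convergent (\<lambda>n. average n x)}"
  define T where "T = Blinfun L"
  have T [simp]: "blinfun_apply T = L"
    by (simp add: T_def bounded_linear_Blinfun_apply bounded_linear)
  have opT: "is_operator sc T" by (simp add: is_operator_def scale)
  assume "\<not> convergent (\<lambda>n. average n x)"
  then have "x \<notin> closure ?D" using closed_average_convergent by blast
  then obtain f where f: "f \<in> dual sc" "\<And>z. convergent (\<lambda>n. average n z) \<Longrightarrow> blinfun_apply f z = 0"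
      "blinfun_apply f x \<noteq> 0"
    using separatingE[OF sep subspace_average_convergent] by (metis mem_Collect_eq)
  have fL: "blinfun_apply f (L z) = blinfun_apply f z" for z
    using f(2)[OF convergentI[OF average_coboundary[of z]]] by (simp add: blinfun.diff_right)
  have fpow: "blinfun_apply f ((L ^^ n) z) = blinfun_apply f z" for n z
    by (induction n) (simp_all add: fL)
  have favg: "blinfun_apply f (average n z) = blinfun_apply f z" if "n \<ge> 1" for n z
    using that by (simp add: average_def blinfun.scaleR_right blinfun.sum_right fpow sum_constant_scaleR del: sum_constant)
  define R where "R = (\<lambda>g. (g o\<^sub>L T) - g) ` dual sc"
  interpret ds: scaled_space "dual_scale :: 'k \<Rightarrow> ('v \<Rightarrow>\<^sub>L 'k) \<Rightarrow> _"
    by unfold_locales (rule normed_scaling_dual_scale)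
  have "ds.subspace R"
  proof (rule ds.subspaceI)
    show "0 \<in> R" unfolding R_def
      by (rule image_eqI[of _ _ 0]) (auto simp: dual_def intro!: blinfun_eqI)
    show "a + b \<in> R" if ab: "a \<in> R" "b \<in> R" for a b
    proof -
      obtain g h where gh: "g \<in> dual sc" "h \<in> dual sc"
        and [simp]: "a = (g o\<^sub>L T) - g" "b = (h o\<^sub>L T) - h"
        using ab unfolding R_def by blast
      have "a + b = ((g + h) o\<^sub>L T) - (g + h)"
        by (rule blinfun_eqI) (simp add: blinfun.bilinear_simps)
      moreover have "g + h \<in> dual sc"
        using gh by (simp add: dual_def blinfun.add_left distrib_left)
      ultimately show ?thesis unfolding R_def by (rule image_eqI)
    qed
    show "dual_scale c a \<in> R" if ab: "a \<in> R" for c a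
    proof -
      obtain g where g: "g \<in> dual sc" and [simp]: "a = (g o\<^sub>L T) - g"
        using ab unfolding R_def by blast
      have "dual_scale c a = (dual_scale c g o\<^sub>L T) - dual_scale c g"
        by (rule blinfun_eqI) (simp add: blinfun.bilinear_simps right_diff_distrib)
      moreover have "dual_scale c g \<in> dual sc"
        using g by (simp add: dual_def)
      ultimately show ?thesis unfolding R_def by (rule image_eqI)
    qed
  qed
  moreover have "f \<notin> closure R"
  proof
    assume "f \<in> closure R"
    \<comment> \<open>Along \<open>average n x\<close> the functional \<open>f\<close> keeps the
      value \<open>f x\<close>, while \<open>h\<close> tends to 0 because it evaluates
      \<open>g\<close> at averages of a coboundary. So \<open>f - h\<close> alone accounts for
      \<open>f x\<close> in the limit, and \<open>h\<close> cannot be too close to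
      \<open>f\<close>.\<close>
    have fx: "norm (blinfun_apply f x) \<le> norm (f - h) * (M * norm x)" if h: "h \<in> R" for h
    proof -
      obtain g where g: "h = (g o\<^sub>L T) - g" using h by (auto simp: R_def)
      have "(\<lambda>n. blinfun_apply g (average n (L x - x))) \<longlonglongrightarrow> blinfun_apply g 0"
        by (intro blinfun.tendsto tendsto_const average_coboundary)
      then have "(\<lambda>n. blinfun_apply h (average n x)) \<longlonglongrightarrow> 0"
        by (simp add: g average_diff average_op blinfun.bilinear_simps)
      then have "(\<lambda>n. norm (f - h) * (M * norm x) + norm (blinfun_apply h (average n x)))
          \<longlonglongrightarrow> norm (f - h) * (M * norm x) + 0"
        by (intro tendsto_add tendsto_const tendsto_norm_zero)
      moreover have "norm (blinfun_apply f x)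
          \<le> norm (f - h) * (M * norm x) + norm (blinfun_apply h (average n x))" if "n \<ge> 1" for n
      proof -
        have "blinfun_apply f x = blinfun_apply (f - h) (average n x) + blinfun_apply h (average n x)"
          using favg[OF that] by (simp add: blinfun.diff_left)
        then have "norm (blinfun_apply f x)
            \<le> norm (blinfun_apply (f - h) (average n x)) + norm (blinfun_apply h (average n x))"
          by (simp only: norm_triangle_ineq)
        also have "norm (blinfun_apply (f - h) (average n x)) \<le> norm (f - h) * norm (average n x)"
          by (rule norm_blinfun)
        also have "\<dots> \<le> norm (f - h) * (M * norm x)"
          by (intro mult_left_mono norm_average_le) simp
        finally show ?thesis by simp
      qed
      ultimately show ?thesis
        using LIMSEQ_le_const[of _ "norm (f - h) * (M * norm x) + 0"] by fastforce
    qed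
    have "x \<noteq> 0" using f(3) by (auto simp: blinfun.zero_right)
    then have "0 < M * norm x" using M_ge_1 by simp
    then have "0 < norm (blinfun_apply f x) / (M * norm x)" using f(3) by simp
    then obtain h where h: "h \<in> R" "dist h f < norm (blinfun_apply f x) / (M * norm x)"
      using \<open>f \<in> closure R\<close> unfolding closure_approachable by blast
    then have "norm (f - h) * (M * norm x) < norm (blinfun_apply f x)"
      using \<open>0 < M * norm x\<close> by (simp add: dist_norm norm_minus_commute less_divide_eq)
    then show False using fx[OF h(1)] by simp
  qed
  ultimately obtain F where F: "F \<in> dual (dual_scale :: 'k \<Rightarrow> ('v \<Rightarrow>\<^sub>L 'k) \<Rightarrow> _)"
      "\<And>h. h \<in> R \<Longrightarrow> blinfun_apply F h = 0" "blinfun_apply F f \<noteq> 0"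
    using separatingE[OF sep'] by metis
  obtain y where y: "\<And>g. g \<in> dual sc \<Longrightarrow> blinfun_apply F g = blinfun_apply g y"
    using reflexive_dual_scaleE[OF refl F(1)] by blast
  \<comment> \<open>As \<open>F\<close> is evaluation at \<open>y\<close> on the dual, its vanishing
    on \<open>R\<close> means that no functional distinguishes \<open>L y\<close> from
    \<open>y\<close>.\<close>
  have "blinfun_apply g (L y - y) = 0" if "g \<in> dual sc" for g
  proof -
    have "blinfun_apply F (g o\<^sub>L T) - blinfun_apply F g = 0"
      using F(2)[of "(g o\<^sub>L T) - g"] that by (simp add: R_def blinfun.diff_right)
    then show ?thesis
      by (simp add: y dual_compose[OF that opT] that blinfun.diff_right)
  qed
  then have "L y - y = 0"
    using separatingE[OF sep subspace_single_0, of "L y - y"] by force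
  then have "(L ^^ n) y = y" for n by (induction n) simp_all
  then have "(\<lambda>n. average n y) \<longlonglongrightarrow> y"
    using tendsto_average[of "\<lambda>n. (L ^^ n) y" y] by (simp add: average_def)
  then show False using f(2)[OF convergentI] y[OF f(1)] F(3) by simp
qed

end

section \<open>Compact perturbations of scalar operators\<close>

text \<open>Completeness of the scalar field makes the dual a Banach space, so that the adjoint is
  an instance of \<open>power_bounded_op\<close> too.\<close>

locale compact_perturbation = power_bounded_op sc L M
  for sc :: "'k::{real_normed_field,banach} \<Rightarrow> 'v::banach \<Rightarrow> 'v" and L M +
  fixes S :: "'v \<Rightarrow>\<^sub>L 'v" and \<alpha> :: 'k and k :: nat
  assumes op_eq: "L x = sc \<alpha> x + blinfun_apply S x"
    and compact: "compact_operator (blinfun_apply S ^^ k)"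
    and separating: "separating sc"
    and separating_dual: "separating (dual_scale :: 'k \<Rightarrow> ('v \<Rightarrow>\<^sub>L 'k) \<Rightarrow> _)"
    and reflexive: "reflexive_space sc"
begin

lemma S_eq: "(\<lambda>x. L x - sc \<alpha> x) = blinfun_apply S"
  by (simp add: op_eq)

lemma is_operator_S: "is_operator sc S"
  unfolding is_operator_def S_eq[symmetric]
  by (simp add: scale scale_right_diff_distrib mult.commute)

lemma S_commute: "L (blinfun_apply S x) = blinfun_apply S (L x)"
  unfolding S_eq[symmetric] by (simp add: op_diff scale)

lemma pow_S_commute: "(L ^^ n) (blinfun_apply S x) = blinfun_apply S ((L ^^ n) x)"
  by (induction n) (simp_all add: S_commute)

definition K :: "'v \<Rightarrow>\<^sub>L 'v" where
  "K = Blinfun (blinfun_apply S ^^ k)"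

lemma K_apply: "blinfun_apply K = blinfun_apply S ^^ k"
  by (simp add: K_def bounded_linear_Blinfun_apply bounded_linear_funpow blinfun.bounded_linear_right)

lemma is_operator_K: "is_operator sc K"
proof -
  have "(blinfun_apply S ^^ n) (sc c x) = sc c ((blinfun_apply S ^^ n) x)" for n c x
    using is_operator_S by (induction n) (simp_all add: is_operator_def)
  then show ?thesis by (simp add: is_operator_def K_apply)
qed

lemma K_commute: "L (blinfun_apply K x) = blinfun_apply K (L x)"
proof -
  have "L ((blinfun_apply S ^^ n) x) = (blinfun_apply S ^^ n) (L x)" for n
    by (induction n) (simp_all add: S_commute)
  then show ?thesis by (simp add: K_apply)
qed

lemma compact_K: "compact_operator (blinfun_apply K)"
  using compact by (simp add: K_apply)

text \<open>The set \<open>W\<close> of mixing vectors is invariant under \<open>S\<close>, because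
  composition with \<open>S\<close> preserves the dual. If \<open>norm (F y)\<close> is a lower
  bound along the orbit, it also bounds the averages from below, and these tend to 0.\<close>

lemma null_if_mixing:
  assumes "\<And>f. f \<in> dual sc \<Longrightarrow>
    (\<lambda>n. (1 / real n) * (\<Sum>j=1..n. norm (blinfun_apply f ((L ^^ j) w)))) \<longlonglongrightarrow> 0"
  shows "w \<in> null"
proof -
  define W where "W = {w. \<forall>f\<in>dual sc.
    (\<lambda>n. (1 / real n) * (\<Sum>j=1..n. norm (blinfun_apply f ((L ^^ j) w)))) \<longlonglongrightarrow> 0}"
  have W_S: "blinfun_apply S y \<in> W" if y: "y \<in> W" for y
    unfolding W_def
  proof (intro CollectI ballI)
    fix f assume "f \<in> dual sc"
    then have "f o\<^sub>L S \<in> dual sc" by (rule dual_compose[OF _ is_operator_S])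
    then have "(\<lambda>n. (1 / real n) * (\<Sum>j=1..n. norm (blinfun_apply (f o\<^sub>L S) ((L ^^ j) y)))) \<longlonglongrightarrow> 0"
      using y unfolding W_def by blast
    then show "(\<lambda>n. (1 / real n) * (\<Sum>j=1..n. norm (blinfun_apply f ((L ^^ j) (blinfun_apply S y))))) \<longlonglongrightarrow> 0"
      by (simp add: pow_S_commute)
  qed
  show ?thesis
  proof (rule null_if_iterate_null[OF separating, of W \<alpha> w k])
    show "w \<in> W" using assms by (simp add: W_def)
    then have "blinfun_apply K w \<in> null"
      by (intro compact_image_null[OF separating _ is_operator_K K_commute compact_K]) (simp add: W_def)
    then show "((\<lambda>y. L y - sc \<alpha> y) ^^ k) w \<in> null"
      by (simp add: S_eq K_apply)
    show "L y - sc \<alpha> y \<in> W" if "y \<in> W" for y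
      using W_S[OF that] by (simp add: op_eq)
    show "blinfun_apply F y = 0" if y: "y \<in> W" and F: "F \<in> dual sc"
      and le: "\<And>n. norm (blinfun_apply F y) \<le> norm (blinfun_apply F ((L ^^ n) y))" for y F
    proof -
      have "(\<lambda>n. (1 / real n) * (\<Sum>j=1..n. norm (blinfun_apply F ((L ^^ j) y)))) \<longlonglongrightarrow> 0"
        using y F by (simp add: W_def)
      moreover have "norm (blinfun_apply F y) \<le> (1 / real n) * (\<Sum>j=1..n. norm (blinfun_apply F ((L ^^ j) y)))"
        if "n \<ge> 1" for n
        using sum_mono[of "{1..n}" "\<lambda>_. norm (blinfun_apply F y)", OF le] that by (simp add: field_simps)
      ultimately have "norm (blinfun_apply F y) \<le> 0"
        by (meson LIMSEQ_le_const)
      then show ?thesis by simp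
    qed
  qed
qed

text \<open>The mean ergodic projection \<open>p\<close> of \<open>x\<close> is fixed by
  \<open>L\<close>, so the orbit of \<open>x\<close> is \<open>p\<close> plus the orbit of the null
  vector \<open>x - p\<close>.\<close>

lemma orbit_convergent:
  assumes "weakly_mixing sc L"
  shows "convergent (\<lambda>n. (L ^^ n) x)"
proof -
  define p where "p = mean_ergodic_proj L x"
  have "(\<lambda>n. average n x) \<longlonglongrightarrow> p"
    using average_convergent[OF separating separating_dual reflexive, of x]
    by (simp add: p_def mean_ergodic_proj_def average_def convergent_LIMSEQ_iff)
  then have "L p = p" by (rule fixed_if_average_tendsto)
  then have fixp: "(L ^^ n) p = p" for n by (induction n) simp_all
  have "x - p \<in> null"
    using assms by (intro null_if_mixing) (simp add: weakly_mixing_def p_def)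
  then have "(\<lambda>n. (L ^^ n) (x - p)) \<longlonglongrightarrow> 0"
    by (simp add: null_def)
  then have "(\<lambda>n. (L ^^ n) x - p) \<longlonglongrightarrow> 0"
    by (simp add: pow_diff fixp)
  then show ?thesis
    by (rule convergentI[OF LIM_zero_cancel])
qed

section \<open>Stability of the adjoint\<close>

abbreviation adj :: "('v \<Rightarrow>\<^sub>L 'k) \<Rightarrow> ('v \<Rightarrow>\<^sub>L 'k)" where
  "adj \<equiv> adjoint_op (Blinfun L)"

lemma adj_apply: "blinfun_apply (adj f) x = blinfun_apply f (L x)"
  by (simp add: adjoint_op_def bounded_linear_Blinfun_apply bounded_linear)

lemma adj_pow_apply: "blinfun_apply ((adj ^^ n) f) x = blinfun_apply f ((L ^^ n) x)"
  by (induction n arbitrary: x) (simp_all add: adj_apply funpow_swap1[of L])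

text \<open>The adjoint acts here on the Banach space of all bounded real-linear maps into the
  scalars; membership in \<open>dual sc\<close> is tracked separately.\<close>

sublocale adj: power_bounded_op dual_scale adj M
proof (intro power_bounded_op.intro scaled_space.intro power_bounded_op_axioms.intro)
  show "normed_scaling (dual_scale :: 'k \<Rightarrow> ('v \<Rightarrow>\<^sub>L 'k) \<Rightarrow> _)"
    by (rule normed_scaling_dual_scale)
  show pow: "norm ((adj ^^ n) f) \<le> M * norm f" for n and f :: "'v \<Rightarrow>\<^sub>L 'k"
  proof (rule norm_blinfun_bound)
    show "0 \<le> M * norm f" using M_ge_1 by simp
    show "norm (blinfun_apply ((adj ^^ n) f) x) \<le> M * norm f * norm x" for x
      using order_trans[OF norm_blinfun[of f "(L ^^ n) x"] mult_left_mono[OF norm_pow_le, of "norm f" n x]]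
      by (simp add: adj_pow_apply mult_ac)
  qed
  show "bounded_linear adj"
  proof (rule bounded_linear_intro[where K = M])
    show "norm (adj f) \<le> norm f * M" for f :: "'v \<Rightarrow>\<^sub>L 'k"
      using pow[of 1 f] by (simp add: mult.commute)
  qed (auto intro!: blinfun_eqI simp: adj_apply blinfun.bilinear_simps)
  show "adj (dual_scale c f) = dual_scale c (adj f)" for c and f :: "'v \<Rightarrow>\<^sub>L 'k"
    by (rule blinfun_eqI) (simp add: adj_apply)
qed (rule M_ge_1)

text \<open>The functionals \<open>g \<circ> L\<^sup>n\<close> are uniformly Lipschitz, hence tend to 0 uniformly on compact sets.\<close>

lemma compose_K_null:
  assumes g: "\<And>x. (\<lambda>n. blinfun_apply g ((L ^^ n) x)) \<longlonglongrightarrow> 0"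
  shows "g o\<^sub>L K \<in> adj.null"
proof (rule adj.null_if_small)
  fix e :: real assume e: "0 < e"
  \<comment> \<open>Each functional \<open>g\<close> after \<open>L ^^ n\<close> has Lipschitz
    constant at most \<open>norm g * M\<close>, so moving by \<open>d\<close> changes its value by
    at most \<open>e / 4\<close>; adding 1 keeps the denominator positive when
    \<open>g = 0\<close>.\<close>
  define d where "d = e / 4 / ((norm g + 1) * M)"
  have d: "0 < d" using e M_ge_1 by (simp add: d_def add_nonneg_pos)
  define C where "C = closure (blinfun_apply K ` cball 0 1)"
  have C: "compact C"
    using compact_K by (simp add: compact_operator_def C_def)
  have "C \<subseteq> (\<Union>c\<in>C. ball c d)" using d by auto
  then obtain C' where C': "C' \<subseteq> C" "finite C'" "C \<subseteq> (\<Union>c\<in>C'. ball c d)"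
    using compactE_image[OF C, of C "\<lambda>c. ball c d"] by (metis open_ball)
  have "\<forall>\<^sub>F n in sequentially. \<forall>c\<in>C'. norm (blinfun_apply g ((L ^^ n) c)) < e / 4"
    using order_tendstoD(2)[OF tendsto_norm_zero[OF g], of "e / 4"] e
    by (intro eventually_ball_finite C'(2) ballI) simp
  then obtain n where n: "\<And>c. c \<in> C' \<Longrightarrow> norm (blinfun_apply g ((L ^^ n) c)) < e / 4"
    using eventually_happens'[OF sequentially_bot] by blast
  let ?h = "(adj ^^ n) (g o\<^sub>L K)"
  have ball: "norm (blinfun_apply ?h x) \<le> e / 2" if "norm x \<le> 1" for x
  proof -
    have "blinfun_apply K x \<in> C"
      unfolding C_def using that by (intro subsetD[OF closure_subset] imageI) simp
    then obtain c where c: "c \<in> C'" "dist c (blinfun_apply K x) < d"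
      using C'(3) by auto
    have K_pow: "(L ^^ n) (blinfun_apply K x) = blinfun_apply K ((L ^^ n) x)" for n
      by (induction n) (simp_all add: K_commute)
    have "blinfun_apply ?h x
        = blinfun_apply g ((L ^^ n) (blinfun_apply K x - c)) + blinfun_apply g ((L ^^ n) c)"
      by (simp add: adj_pow_apply pow_diff blinfun.diff_right K_pow)
    then have "norm (blinfun_apply ?h x)
        \<le> norm (blinfun_apply g ((L ^^ n) (blinfun_apply K x - c))) + norm (blinfun_apply g ((L ^^ n) c))"
      by (simp only: norm_triangle_ineq)
    also have "norm (blinfun_apply g ((L ^^ n) (blinfun_apply K x - c)))
        \<le> norm g * (M * norm (blinfun_apply K x - c))"
      using norm_blinfun[of g] norm_pow_le by (meson mult_left_mono norm_ge_zero order_trans)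
    also have "\<dots> \<le> (norm g + 1) * (M * d)"
      using c(2) M_ge_1 by (intro mult_mono) (auto simp: dist_norm norm_minus_commute less_imp_le)
    also have "\<dots> = e / 4"
    proof -
      have "(norm g + 1) * M \<noteq> 0" using norm_ge_zero[of g] M_ge_1 by (smt (verit) mult_eq_0_iff)
      then show ?thesis
        unfolding d_def mult.assoc[symmetric] by (rule nonzero_mult_div_cancel_left[THEN trans[OF times_divide_eq_right]])
    qed
    finally show ?thesis using n[OF c(1)] by simp
  qed
  have "norm ?h \<le> e / 2"
  proof (rule norm_blinfun_bound)
    show "norm (blinfun_apply ?h x) \<le> e / 2 * norm x" for x
    proof (cases "x = 0")
      case True
      then show ?thesis by (simp add: blinfun.zero_right)
    next
      case False
      then show ?thesis
        using ball[of "(1 / norm x) *\<^sub>R x"] by (simp add: blinfun.scaleR_right field_simps)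
    qed
  qed (use e in simp)
  then show "\<exists>n. norm ((adj ^^ n) (g o\<^sub>L K)) < e"
    using e by (intro exI[of _ n]) simp
qed

text \<open>The descent for the adjoint, with \<open>W\<close> the functionals tending to 0 along
  every orbit of \<open>L\<close>. The \<open>k\<close>-th iterate of \<open>?Q\<close> maps
  \<open>g\<close> to \<open>g o\<^sub>L K\<close>, which is null by compactness.\<close>

lemma adj_null:
  assumes g: "g \<in> dual sc" "\<And>x. (\<lambda>n. blinfun_apply g ((L ^^ n) x)) \<longlonglongrightarrow> 0"
  shows "g \<in> adj.null"
proof -
  define W where "W = {g \<in> dual sc. \<forall>x. (\<lambda>n. blinfun_apply g ((L ^^ n) x)) \<longlonglongrightarrow> 0}"
  let ?Q = "\<lambda>f. adj f - dual_scale \<alpha> f"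
  \<comment> \<open>Uses \<open>f (sc \<alpha> x) = \<alpha> * f x\<close>, hence the restriction to
    \<open>dual sc\<close>.\<close>
  have Q: "?Q f = f o\<^sub>L S" if "f \<in> dual sc" for f
    using that by (intro blinfun_eqI) (simp add: adj_apply op_eq blinfun.bilinear_simps dual_def)
  have Q_pow: "blinfun_apply ((?Q ^^ n) f) x = blinfun_apply f ((blinfun_apply S ^^ n) x)"
    if "f \<in> dual sc" for n f x
    using that
  proof (induction n arbitrary: f)
    case (Suc n)
    have "blinfun_apply ((?Q ^^ Suc n) f) x = blinfun_apply ((?Q ^^ n) (f o\<^sub>L S)) x"
      by (simp only: funpow_Suc_right o_apply Q[OF Suc.prems])
    then show ?case
      using Suc.IH[OF dual_compose[OF Suc.prems is_operator_S]] by simp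
  qed simp
  show ?thesis
  proof (rule adj.null_if_iterate_null[OF separating_dual, of W \<alpha> g k])
    show "g \<in> W" using g by (simp add: W_def)
    have "(?Q ^^ k) g = g o\<^sub>L K"
      by (rule blinfun_eqI) (simp add: Q_pow[OF g(1)] K_apply)
    then show "(?Q ^^ k) g \<in> adj.null"
      using compose_K_null[OF g(2)] by simp
    show "?Q f \<in> W" if "f \<in> W" for f
    proof -
      have f: "f \<in> dual sc" "\<And>x. (\<lambda>n. blinfun_apply f ((L ^^ n) x)) \<longlonglongrightarrow> 0"
        using that by (auto simp: W_def)
      have "(\<lambda>n. blinfun_apply (f o\<^sub>L S) ((L ^^ n) x)) \<longlonglongrightarrow> 0" for x
        using f(2)[of "blinfun_apply S x"] by (simp add: pow_S_commute)
      then show ?thesis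
        using dual_compose[OF f(1) is_operator_S] by (simp add: Q[OF f(1)] W_def)
    qed
    show "blinfun_apply F f = 0"
      if f: "f \<in> W" and F: "F \<in> dual (dual_scale :: 'k \<Rightarrow> ('v \<Rightarrow>\<^sub>L 'k) \<Rightarrow> _)"
        and le: "\<And>n. norm (blinfun_apply F f) \<le> norm (blinfun_apply F ((adj ^^ n) f))" for f F
    proof -
      \<comment> \<open>Reflexivity turns \<open>F\<close> into evaluation at some \<open>x\<close>
        on the dual, and \<open>f\<close> tends to 0 along the orbit of \<open>x\<close>.\<close>
      obtain x where x: "\<And>h. h \<in> dual sc \<Longrightarrow> blinfun_apply F h = blinfun_apply h x"
        using reflexive_dual_scaleE[OF reflexive F] by blast
      have "(adj ^^ n) f \<in> dual sc" for n
        using f by (simp add: W_def dual_def adj_pow_apply pow_scale)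
      then have "norm (blinfun_apply F f) \<le> norm (blinfun_apply f ((L ^^ n) x))" for n
        using le[of n] x by (simp add: adj_pow_apply)
      moreover have "(\<lambda>n. norm (blinfun_apply f ((L ^^ n) x))) \<longlonglongrightarrow> 0"
        using f by (simp add: W_def tendsto_norm_zero)
      ultimately have "norm (blinfun_apply F f) \<le> 0"
        by (meson LIMSEQ_le_const)
      then show ?thesis by simp
    qed
  qed
qed

text \<open>The pointwise limit \<open>E\<close> of the powers is bounded with
  \<open>E (L x) = E x\<close>, so \<open>f\<close> composed with \<open>E\<close> is fixed by the
  adjoint. Its difference from \<open>f\<close> tends to 0 along every orbit of \<open>L\<close> and
  is therefore null for the adjoint.\<close>

lemma adj_orbit_convergent:
  assumes conv: "\<And>x. convergent (\<lambda>n. (L ^^ n) x)" and f: "f \<in> dual sc"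
  shows "convergent (\<lambda>n. (adj ^^ n) f)"
proof -
  define E where "E x = lim (\<lambda>n. (L ^^ n) x)" for x
  have E: "(\<lambda>n. (L ^^ n) x) \<longlonglongrightarrow> E x" for x
    using conv[of x] by (simp add: E_def convergent_LIMSEQ_iff)
  have E_scale: "E (sc c x) = sc c (E x)" for c x
    using E[of "sc c x"] bounded_linear.tendsto[OF bounded_linear_scale[of c] E[of x]]
    by (intro LIMSEQ_unique) (simp_all add: pow_scale)
  have blE: "bounded_linear E"
  proof (rule bounded_linear_intro[where K = M])
    show "E (x + y) = E x + E y" for x y
      using E[of "x + y"] tendsto_add[OF E[of x] E[of y]]
      by (intro LIMSEQ_unique) (simp_all add: pow_add)
    show "E (r *\<^sub>R x) = r *\<^sub>R E x" for r x
      using E_scale[of "of_real r" x] by simp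
    show "norm (E x) \<le> norm x * M" for x
      using tendsto_norm[OF E[of x]] norm_pow_le[of _ x]
      by (intro LIMSEQ_le_const2) (auto simp: mult.commute)
  qed
  have "E (L x) = E x" for x
    using E[of "L x"] LIMSEQ_Suc[OF E[of x]]
    by (intro LIMSEQ_unique) (simp_all add: funpow_swap1)
  then have E_pow: "E ((L ^^ n) x) = E x" for n x
    by (induction n) simp_all
  define fE where "fE = f o\<^sub>L Blinfun E"
  have fE: "blinfun_apply fE x = blinfun_apply f (E x)" for x
    by (simp add: fE_def bounded_linear_Blinfun_apply blE)
  have "f - fE \<in> adj.null"
  proof (rule adj_null)
    show "f - fE \<in> dual sc"
      using f by (simp add: dual_def blinfun.diff_left fE E_scale right_diff_distrib)
    have "(\<lambda>n. blinfun_apply f ((L ^^ n) x) - blinfun_apply f (E x)) \<longlonglongrightarrow> 0" for x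
      by (intro LIM_zero blinfun.tendsto tendsto_const E)
    then show "(\<lambda>n. blinfun_apply (f - fE) ((L ^^ n) x)) \<longlonglongrightarrow> 0" for x
      by (simp add: blinfun.diff_left fE E_pow)
  qed
  moreover have "(adj ^^ n) (f - fE) = (adj ^^ n) f - fE" for n
    by (rule blinfun_eqI) (simp add: adj_pow_apply blinfun.diff_left fE E_pow)
  ultimately have "(\<lambda>n. (adj ^^ n) f - fE) \<longlonglongrightarrow> 0"
    by (simp add: adj.null_def)
  then show ?thesis
    by (rule convergentI[OF LIM_zero_cancel])
qed

end

section \<open>Real and complex scalars\<close>

lemma power_boundedE:
  assumes "power_bounded (blinfun_apply (T :: 'v::real_normed_vector \<Rightarrow>\<^sub>L 'v))"
  obtains M where "1 \<le> M" "\<And>n x. norm ((blinfun_apply T ^^ n) x) \<le> M * norm x"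
proof -
  obtain B where B: "\<And>n. onorm (blinfun_apply T ^^ n) \<le> B"
    using assms by (auto simp: power_bounded_def bdd_above_def)
  have "onorm (blinfun_apply T ^^ n) \<le> max 1 B" for n
    using B[of n] by simp
  then have "norm ((blinfun_apply T ^^ n) x) \<le> max 1 B * norm x" for n x
    by (rule order_trans[OF onorm[OF bounded_linear_funpow[OF blinfun.bounded_linear_right]]
          mult_right_mono[OF _ norm_ge_zero]])
  then show ?thesis by (intro that[of "max 1 B"]) auto
qed

lemma weakly_mixing_compact_perturbation_stable:
  fixes sc :: "'k::{real_normed_field,banach} \<Rightarrow> 'v::banach \<Rightarrow> 'v"
  assumes "normed_scaling sc" "separating sc" "separating (dual_scale :: 'k \<Rightarrow> ('v \<Rightarrow>\<^sub>L 'k) \<Rightarrow> _)"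
    and "reflexive_space sc" "is_operator sc T" "power_bounded (blinfun_apply T)"
    and mix: "weakly_mixing sc (blinfun_apply T)"
    and "\<And>x. blinfun_apply T x = sc \<alpha> x + blinfun_apply S x"
    and "compact_operator (blinfun_apply S ^^ k)"
  shows "stable_on UNIV (blinfun_apply T) \<and> stable_on (dual sc) (adjoint_op T)"
proof -
  obtain M where M: "1 \<le> M" "\<And>n x. norm ((blinfun_apply T ^^ n) x) \<le> M * norm x"
    using power_boundedE[OF assms(6)] by blast
  interpret compact_perturbation sc "blinfun_apply T" M S \<alpha> k
    using assms(1-5,8-) M
    by (intro compact_perturbation.intro power_bounded_op.intro scaled_space.intro
        power_bounded_op_axioms.intro compact_perturbation_axioms.intro blinfun.bounded_linear_right)
      (auto simp: is_operator_def)
  show ?thesis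
    using orbit_convergent[OF mix] adj_orbit_convergent[OF orbit_convergent[OF mix]]
    by (auto intro!: stable_onI simp: blinfun_apply_inverse)
qed

theorem theorem2p5:
  shows
    "(\<forall>(T :: 'a::banach \<Rightarrow>\<^sub>L 'a) (S :: 'a \<Rightarrow>\<^sub>L 'a) (\<alpha> :: real) (k :: nat).
        reflexive_space (scaleR :: real \<Rightarrow> 'a \<Rightarrow> 'a) \<longrightarrow>
        power_bounded (blinfun_apply T) \<longrightarrow>
        weakly_mixing (scaleR :: real \<Rightarrow> 'a \<Rightarrow> 'a) (blinfun_apply T) \<longrightarrow>
        (\<forall>x. blinfun_apply T x = \<alpha> *\<^sub>R x + blinfun_apply S x) \<longrightarrow>
        k \<ge> 1 \<longrightarrow> compact_operator (blinfun_apply S ^^ k) \<longrightarrow>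
        stable_on UNIV (blinfun_apply T) \<and>
        stable_on (dual (scaleR :: real \<Rightarrow> 'a \<Rightarrow> 'a)) (adjoint_op T)) \<and>
     (\<forall>(sc :: complex \<Rightarrow> 'a \<Rightarrow> 'a) (T :: 'a \<Rightarrow>\<^sub>L 'a) (S :: 'a \<Rightarrow>\<^sub>L 'a) (\<alpha> :: complex) (k :: nat).
        normed_scaling sc \<longrightarrow>
        reflexive_space sc \<longrightarrow>
        is_operator sc T \<longrightarrow> is_operator sc S \<longrightarrow>
        power_bounded (blinfun_apply T) \<longrightarrow>
        weakly_mixing sc (blinfun_apply T) \<longrightarrow>
        (\<forall>x. blinfun_apply T x = sc \<alpha> x + blinfun_apply S x) \<longrightarrow>
        k \<ge> 1 \<longrightarrow> compact_operator (blinfun_apply S ^^ k) \<longrightarrow>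
        stable_on UNIV (blinfun_apply T) \<and>
        stable_on (dual sc) (adjoint_op T))"
proof -
  \<comment> \<open>Over the reals the only normed scaling is \<open>scaleR\<close>, so real
    separation applies to the dual as well.\<close>
  have dual_real: "separating (dual_scale :: real \<Rightarrow> ('a \<Rightarrow>\<^sub>L real) \<Rightarrow> _)"
    using normed_scaling_dual_scale separating_real by (metis normed_scaling_real_iff)
  have dual_complex: "separating (dual_scale :: complex \<Rightarrow> ('a \<Rightarrow>\<^sub>L complex) \<Rightarrow> _)"
    by (intro separating_complex normed_scaling_dual_scale)
  have real: "stable_on UNIV (blinfun_apply T) \<and> stable_on (dual (scaleR :: real \<Rightarrow> 'a \<Rightarrow> 'a)) (adjoint_op T)"
    if "reflexive_space (scaleR :: real \<Rightarrow> 'a \<Rightarrow> 'a)" "power_bounded (blinfun_apply T)"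
      "weakly_mixing (scaleR :: real \<Rightarrow> 'a \<Rightarrow> 'a) (blinfun_apply T)"
      "\<forall>x. blinfun_apply T x = \<alpha> *\<^sub>R x + blinfun_apply S x"
      "compact_operator (blinfun_apply S ^^ k)"
    for T S :: "'a \<Rightarrow>\<^sub>L 'a" and \<alpha> k
    using that
    by (intro weakly_mixing_compact_perturbation_stable[OF _ separating_real dual_real])
      (auto simp: normed_scaling_real_iff is_operator_def blinfun.scaleR_right)
  have complex: "stable_on UNIV (blinfun_apply T) \<and> stable_on (dual sc) (adjoint_op T)"
    if "normed_scaling sc" "reflexive_space sc" "is_operator sc T" "power_bounded (blinfun_apply T)"
      "weakly_mixing sc (blinfun_apply T)" "\<forall>x. blinfun_apply T x = sc \<alpha> x + blinfun_apply S x"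
      "compact_operator (blinfun_apply S ^^ k)"
    for sc :: "complex \<Rightarrow> 'a \<Rightarrow> 'a" and T S :: "'a \<Rightarrow>\<^sub>L 'a" and \<alpha> k
    using that
    by (intro weakly_mixing_compact_perturbation_stable[OF _ separating_complex dual_complex]) auto
  show ?thesis
    using real complex by blast
qed

end
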